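(* Let $n\ge 2$ be an integer and let $G$ be a finite simple graph satisfying \[ o(G-S)\le 2n\,|S|\quad\text{for all } S\subseteq V(G). \] Then $G$ contains an $H_n$-factor.
   Context: For an integer $n\ge 2$, an $H_n$-factor of a graph $G$ is a spanning subgraph $F$ of $G$ such that $d_F(v)\in\{1,3,5,\ldots,2n-1,2n\}$ for every vertex $v\in V(G)$, where $d_F(v)$ is the degree of $v$ in $F$. For $S\subseteq V(G)$, $G-S$ denotes the subgraph obtained from $G$ by removing all vertices in $S$. $o(G)$ denotes the number of odd components of $G$, i.e. connected components with an odd number of vertices. The subset $S=\emptyset$ is included in the condition. *)

theory Defs
  imports "Graph_Theory.Graph_Theory"
begin

text \<open>A finite simple graph is a \<^locale>\<open>graph\<close>: a finite loop-free symmetric digraph without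
  parallel arcs, every undirected edge being represented by its two opposite arcs.\<close>

definition del_verts :: "('a, 'b) pre_digraph \<Rightarrow> 'a set \<Rightarrow> ('a, 'b) pre_digraph" where
  "del_verts G S = G \<restriction> (verts G - S)"

definition components :: "('a, 'b) pre_digraph \<Rightarrow> ('a, 'b) pre_digraph set" where
  "components G = {C. pre_digraph.max_subgraph G connected C}"

text \<open>The null graph is not \<^const>\<open>connected\<close>, so it is never counted and has no components itself.\<close>

definition num_odd_components :: "('a, 'b) pre_digraph \<Rightarrow> nat" where
  "num_odd_components G = card {C \<in> components G. odd (card (verts C))}"

text \<open>\<^prop>\<open>graph F\<close> makes the arc set of \<open>F\<close> symmetric, i.e. \<open>F\<close> arises by selecting undirected edges
  of \<open>G\<close>; the number of outgoing arcs at a vertex is then its undirected degree.\<close>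

definition H_factor :: "nat \<Rightarrow> ('a, 'b) pre_digraph \<Rightarrow> ('a, 'b) pre_digraph \<Rightarrow> bool" where
  "H_factor n G F \<longleftrightarrow> graph F \<and> spanning F G \<and>
     (\<forall>v \<in> verts G. out_degree F v \<in> {2 * i + 1 | i. i < n} \<union> {2 * n})"

end

theory Submission
  imports Defs
begin

text \<open>Put \<open>m = 2 * n - 1\<close> and write \<open>oc (V - S)\<close> for the number of odd components left after deleting
  \<open>S\<close>. The idea is to let the vertices of degree \<open>2 * n\<close> lie in one set \<open>S\<close>, chosen so that the surplus
  \<open>oc (V - S) - m * card S\<close> is maximal and that \<open>S\<close> is inclusion-maximal with this property.

  Each odd component of \<open>V - S\<close> is to be joined to \<open>S\<close> by exactly one edge. Maximality of the surplus
  says that every \<open>B \<subseteq> S\<close> has at least \<open>m * card B\<close> odd components as neighbours, and the hypothesis of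
  the theorem says that \<open>k\<close> odd components always have at least \<open>k / (2 * n)\<close> neighbours in \<open>S\<close>. A
  two-sided version of Hall's theorem (\<open>bounded_assignment\<close>) turns this into a distribution of the odd
  components in which every vertex of \<open>S\<close> receives either \<open>m\<close> or \<open>m + 1 = 2 * n\<close> of them.

  Inclusion-maximality of \<open>S\<close> and parity show that each even component, and each odd component with
  its edge to \<open>S\<close> attached, satisfies the stronger condition \<open>oc (V - T) \<le> m * card T\<close>
  (\<open>even_component_hypothesis\<close>, \<open>odd_component_hypothesis\<close>). By Amahashi's theorem
  (\<open>odd_factor_exists\<close>) these graphs have factors with all degrees odd and at most \<open>m\<close>, and the union
  of these factors is the required one (\<open>glue_factors\<close>).

  Amahashi's theorem itself follows by induction from the same construction, in which the vertices of
  \<open>S\<close> then receive exactly \<open>m\<close> components each, whenever the condition is tight for a nonempty set. If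
  it is not, edges can be deleted until every edge is a bridge with two odd sides. In that case the
  graph is its own factor, because the degree of \<open>v\<close> is the number of odd components left by deleting
  \<open>v\<close>.\<close>

section \<open>Components of a symmetric relation on a set of vertices\<close>

definition sealed :: "'a rel \<Rightarrow> 'a set \<Rightarrow> 'a set \<Rightarrow> bool" where
  "sealed E W X \<longleftrightarrow> (\<forall>a b. (a, b) \<in> E \<longrightarrow> a \<in> X \<longrightarrow> b \<in> W \<longrightarrow> b \<in> X)"

text \<open>Connectedness is phrased by cuts instead of walks, because both conditions on a component then
  visibly depend only on the edges near it: this is what makes comparing the components of two
  different vertex sets or edge sets easy.\<close>
definition linked :: "'a rel \<Rightarrow> 'a set \<Rightarrow> bool" where
  "linked E X \<longleftrightarrow> X \<noteq> {} \<and> (\<forall>Y \<subseteq> X. Y \<noteq> {} \<longrightarrow> sealed E X Y \<longrightarrow> Y = X)"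

definition comps :: "'a rel \<Rightarrow> 'a set \<Rightarrow> 'a set set" where
  "comps E W = {X. X \<subseteq> W \<and> linked E X \<and> sealed E W X}"

definition odd_comps :: "'a rel \<Rightarrow> 'a set \<Rightarrow> 'a set set" where
  "odd_comps E W = {X \<in> comps E W. odd (card X)}"

abbreviation oc :: "'a rel \<Rightarrow> 'a set \<Rightarrow> nat" where
  "oc E W \<equiv> card (odd_comps E W)"

lemma sealedD: "sealed E W X \<Longrightarrow> (a, b) \<in> E \<Longrightarrow> a \<in> X \<Longrightarrow> b \<in> W \<Longrightarrow> b \<in> X"
  unfolding sealed_def by blast

lemma linked_subset_sealed:
  assumes "linked E X" "X \<subseteq> W" "sealed E W D" "X \<inter> D \<noteq> {}"
  shows "X \<subseteq> D"
proof -
  have "sealed E X (X \<inter> D)"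
    using assms(2,3) unfolding sealed_def by blast
  then have "X \<inter> D = X"
    using assms(1,4) unfolding linked_def by blast
  then show ?thesis by blast
qed

lemma linked_mono:
  assumes "linked E X" "E \<inter> X \<times> X \<subseteq> E'"
  shows "linked E' X"
proof -
  have "sealed E X Y" if "sealed E' X Y" "Y \<subseteq> X" for Y
    using that assms(2) unfolding sealed_def by blast
  then show ?thesis using assms(1) unfolding linked_def by blast
qed

lemma compsD:
  assumes "X \<in> comps E W"
  shows "X \<subseteq> W" "linked E X" "sealed E W X" "X \<noteq> {}"
  using assms unfolding comps_def linked_def by auto

lemma comps_eq:
  assumes "X \<in> comps E W" "Y \<in> comps E W" "X \<inter> Y \<noteq> {}"
  shows "X = Y"
  using assms linked_subset_sealed[of E X W Y] linked_subset_sealed[of E Y W X]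
  unfolding comps_def by blast

lemma finite_comps: "finite W \<Longrightarrow> finite (comps E W)"
  by (rule finite_subset[of _ "Pow W"]) (auto simp: comps_def)

lemma odd_comps_sub: "odd_comps E W \<subseteq> comps E W"
  unfolding odd_comps_def by blast

lemma finite_odd_comps: "finite W \<Longrightarrow> finite (odd_comps E W)"
  using finite_comps odd_comps_sub finite_subset by metis

text \<open>The component of \<open>x\<close> is the smallest sealed set around \<open>x\<close>; symmetry is needed so that the
  complement of a sealed set is sealed again.\<close>
lemma comps_cover:
  assumes "finite W" "sym E" "x \<in> W"
  obtains X where "X \<in> comps E W" "x \<in> X"
proof -
  define P where "P X \<longleftrightarrow> X \<subseteq> W \<and> sealed E W X \<and> x \<in> X" for X
  have "P W" unfolding P_def sealed_def using assms(3) by blast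
  then obtain X where X: "P X" and least: "\<And>Y. P Y \<Longrightarrow> card X \<le> card Y"
    using ex_has_least_nat[of P W card] by blast
  have finX: "finite X" using X assms(1) finite_subset unfolding P_def by blast
  have "Y = X" if Y: "Y \<subseteq> X" "Y \<noteq> {}" "sealed E X Y" for Y
  proof (cases "x \<in> Y")
    case True
    have "P Y" using True X Y unfolding P_def sealed_def by blast
    then show ?thesis using least[of Y] Y finX card_seteq by blast
  next
    case False
    have "P (X - Y)"
      using False X Y(1,3) assms(2) unfolding P_def sealed_def sym_def by blast
    moreover have "card (X - Y) < card X" using Y finX by (intro psubset_card_mono) auto
    ultimately show ?thesis using least[of "X - Y"] by linarith
  qed
  then have "X \<in> comps E W" using X unfolding comps_def linked_def P_def by blast
  with X that show ?thesis unfolding P_def by blast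
qed

lemma oc_parity:
  assumes "finite W" "sym E"
  shows "even (oc E W) \<longleftrightarrow> even (card W)"
proof -
  have "\<exists>X \<in> comps E W. x \<in> X" if "x \<in> W" for x
    using comps_cover[OF assms that] by metis
  then have "W = \<Union> (comps E W)" using compsD(1) by blast
  moreover have dis: "pairwise disjnt (comps E W)"
    using comps_eq unfolding pairwise_def disjnt_def by blast
  moreover have fin: "finite X" if "X \<in> comps E W" for X
    using compsD(1)[OF that] assms(1) finite_subset by blast
  ultimately have "card W = sum card (comps E W)"
    using card_Union_disjoint[OF dis fin] by simp
  then show ?thesis
    using even_sum_iff[OF finite_comps[OF assms(1)], of card E] unfolding odd_comps_def by simp
qed

lemma comps_self:
  assumes "linked E X"
  shows "comps E X = {X}"
  using assms linked_subset_sealed[of E X X] unfolding comps_def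
  by (auto simp: sealed_def linked_def)

lemma comps_Restr:
  assumes "E \<inter> W \<times> W = E' \<inter> W \<times> W"
  shows "comps E W = comps E' W"
proof -
  have "A \<subseteq> B" if "A = comps E W" "B = comps E' W" "E \<inter> W \<times> W = E' \<inter> W \<times> W" for A B E E'
  proof
    fix X assume "X \<in> A"
    then have X: "X \<subseteq> W" "linked E X" "sealed E W X" using that unfolding comps_def by auto
    have "linked E' X" using X that(3) by (intro linked_mono[OF X(2)]) blast
    moreover have "sealed E' W X" using X that(3) unfolding sealed_def by blast
    ultimately show "X \<in> B" using X that unfolding comps_def by blast
  qed
  then show ?thesis using assms by (metis subset_antisym)
qed

lemma oc_Restr: "E \<inter> W \<times> W = E' \<inter> W \<times> W \<Longrightarrow> oc E W = oc E' W"
  using comps_Restr[of E W E'] unfolding odd_comps_def by simp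

lemma odd_comps_at_vertex:
  assumes "finite W"
  shows "finite {X \<in> odd_comps E W. x \<in> X}" "card {X \<in> odd_comps E W. x \<in> X} \<le> 1"
proof -
  let ?N = "{X \<in> odd_comps E W. x \<in> X}"
  show fin: "finite ?N" using finite_odd_comps[OF assms, of E] by simp
  have "X = Y" if "X \<in> ?N" "Y \<in> ?N" for X Y
    using that comps_eq[of X E W Y] unfolding odd_comps_def by blast
  then show "card ?N \<le> 1" using card_le_Suc0_iff_eq[OF fin] by simp
qed

text \<open>Adding a vertex only creates one new component, the one around that vertex.\<close>
lemma oc_insert:
  assumes "finite W"
  shows "oc E (insert s W) \<le> oc E W + 1"
proof -
  define N where "N = {X \<in> odd_comps E (insert s W). s \<in> X}"
  have N: "finite N" "card N \<le> 1"
    using odd_comps_at_vertex[of "insert s W" E s] assms unfolding N_def by auto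
  have "odd_comps E (insert s W) \<subseteq> odd_comps E W \<union> N"
    unfolding N_def odd_comps_def comps_def sealed_def by blast
  then have "oc E (insert s W) \<le> card (odd_comps E W \<union> N)"
    using N(1) finite_odd_comps[OF assms, of E] by (intro card_mono) auto
  also have "\<dots> \<le> oc E W + card N" by (rule card_Un_le)
  finally show ?thesis using N(2) by linarith
qed

text \<open>Likewise, deleting an edge only creates new components around its two ends.\<close>
lemma comps_delete_edge:
  assumes "X \<in> comps (E - {(u, v), (v, u)}) W" "u \<notin> X \<and> v \<notin> X \<or> u \<in> X \<and> v \<in> X"
  shows "X \<in> comps E W"
  using assms linked_mono[of "E - {(u, v), (v, u)}" X E] unfolding comps_def sealed_def by blast

lemma oc_delete_edge:
  assumes "finite W"
  shows "oc (E - {(u, v), (v, u)}) W \<le> oc E W + 2"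
proof -
  let ?E = "E - {(u, v), (v, u)}"
  define N where "N x = {X \<in> odd_comps ?E W. x \<in> X}" for x
  have fin: "finite (N x)" and one: "card (N x) \<le> 1" for x
    using odd_comps_at_vertex[OF assms, of ?E x] unfolding N_def by auto
  have "odd_comps ?E W \<subseteq> odd_comps E W \<union> (N u \<union> N v)"
    using comps_delete_edge[of _ E u v W] unfolding odd_comps_def N_def by blast
  then have "oc ?E W \<le> card (odd_comps E W \<union> (N u \<union> N v))"
    using fin finite_odd_comps[OF assms] by (intro card_mono) auto
  also have "\<dots> \<le> oc E W + (card (N u) + card (N v))"
    by (meson add_left_mono card_Un_le order_trans)
  finally show ?thesis using one[of u] one[of v] by linarith
qed

text \<open>Deleting vertices from a single component leaves all other components intact.\<close>
lemma oc_delete_in_component: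
  assumes "finite W" "C \<in> comps E W" "T \<subseteq> C"
  shows "card (odd_comps E W - {C}) + oc E (C - T) \<le> oc E (W - T)"
proof -
  have dis: "X \<inter> C = {}" if "X \<in> comps E W" "X \<noteq> C" for X using comps_eq that assms(2) by blast
  have sub1: "odd_comps E W - {C} \<subseteq> odd_comps E (W - T)"
    using dis assms(3) unfolding odd_comps_def comps_def sealed_def by blast
  have sub2: "odd_comps E (C - T) \<subseteq> odd_comps E (W - T)"
    using compsD[OF assms(2)] unfolding odd_comps_def comps_def sealed_def by blast
  have "X \<notin> odd_comps E (C - T)" if "X \<in> odd_comps E W - {C}" for X
    using dis[of X] compsD(1,4)[of X E "C - T"] that unfolding odd_comps_def by blast
  then have "(odd_comps E W - {C}) \<inter> odd_comps E (C - T) = {}" by blast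
  moreover have "finite (odd_comps E W - {C})" "finite (odd_comps E (C - T))"
    using finite_odd_comps assms(1) finite_subset[OF compsD(1)[OF assms(2)] assms(1)] by blast+
  ultimately have "card (odd_comps E W - {C}) + oc E (C - T)
      = card ((odd_comps E W - {C}) \<union> odd_comps E (C - T))"
    by (intro card_Un_disjoint[symmetric])
  also have "\<dots> \<le> oc E (W - T)"
    using sub1 sub2 finite_odd_comps[of "W - T" E] assms(1) by (intro card_mono) auto
  finally show ?thesis .
qed

section \<open>Distributing sets among representatives with two-sided bounds\<close>

text \<open>A relation \<open>R\<close> from \<open>Q\<close> to \<open>S\<close> is feasible if Hall's condition for assigning every element of
  \<open>Q\<close>, with at most \<open>K\<close> assigned to each element of \<open>S\<close>, and Hall's condition for giving \<open>L\<close>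
  elements of \<open>Q\<close> to each element of \<open>S\<close> both hold.\<close>
definition feasible :: "nat \<Rightarrow> nat \<Rightarrow> 'q set \<Rightarrow> 's set \<Rightarrow> ('q \<times> 's) set \<Rightarrow> bool" where
  "feasible L K Q S R \<longleftrightarrow> R \<subseteq> Q \<times> S \<and>
     (\<forall>A \<subseteq> Q. card A \<le> K * card (R `` A)) \<and> (\<forall>B \<subseteq> S. L * card B \<le> card (R\<inverse> `` B))"

text \<open>If deleting an edge destroys feasibility, then some set \<open>A\<close> has too few partners without that
  edge, or the condition for some set \<open>B\<close> is tight and only that edge makes \<open>q\<close> a partner of \<open>B\<close>.\<close>
lemma infeasible_delete:
  assumes "finite Q" "finite S" "feasible L K Q S R" "(q, s) \<in> R"
    and "\<not> feasible L K Q S (R - {(q, s)})"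
  obtains (upper) A where "A \<subseteq> Q" "q \<in> A" "K * card ((R - {(q, s)}) `` A) < card A"
    | (lower) B where "B \<subseteq> S" "s \<in> B" "R `` {q} \<inter> B = {s}" "card (R\<inverse> `` B) = L * card B"
proof -
  let ?R = "R - {(q, s)}"
  have R: "R \<subseteq> Q \<times> S" using assms(3) unfolding feasible_def by blast
  then have "?R \<subseteq> Q \<times> S" by blast
  then consider A where "A \<subseteq> Q" "K * card (?R `` A) < card A"
    | B where "B \<subseteq> S" "card (?R\<inverse> `` B) < L * card B"
    using assms(5) unfolding feasible_def by (meson not_le)
  then show ?thesis
  proof cases
    case 1
    have "q \<in> A"
    proof (rule ccontr)
      assume "q \<notin> A"
      then have "?R `` A = R `` A" by blast
      moreover have "card A \<le> K * card (R `` A)"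
        using 1 assms(3) unfolding feasible_def by blast
      ultimately show False using 1 by simp
    qed
    then show ?thesis using 1 upper by blast
  next
    case 2
    have fin: "finite (R\<inverse> `` B)" using R by (intro finite_subset[OF _ assms(1)]) blast
    have L: "L * card B \<le> card (R\<inverse> `` B)" using assms(3) 2 unfolding feasible_def by blast
    have "R\<inverse> `` B \<subseteq> insert q (?R\<inverse> `` B)" by blast
    moreover have "finite (?R\<inverse> `` B)" by (rule finite_subset[OF _ fin]) blast
    ultimately have le: "card (R\<inverse> `` B) \<le> card (insert q (?R\<inverse> `` B))" by (intro card_mono) auto
    have q: "q \<notin> ?R\<inverse> `` B"
    proof
      assume "q \<in> ?R\<inverse> `` B"
      then have "card (insert q (?R\<inverse> `` B)) = card (?R\<inverse> `` B)" by (simp add: insert_absorb)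
      then show False using le L 2 by linarith
    qed
    then have eq: "card (R\<inverse> `` B) = L * card B"
      using le L 2 \<open>finite (?R\<inverse> `` B)\<close> by simp
    have "s \<in> B"
    proof (rule ccontr)
      assume "s \<notin> B"
      then have "?R\<inverse> `` B = R\<inverse> `` B" by blast
      then show False using 2 L by simp
    qed
    moreover have "R `` {q} \<inter> B = {s}" using q \<open>s \<in> B\<close> assms(4) by blast
    ultimately show ?thesis using 2 eq lower by blast
  qed
qed

text \<open>Rado's argument: in a minimal feasible relation no \<open>q\<close> has two partners. Otherwise
  each of two edges at \<open>q\<close> has a set obstructing its deletion, and the union and intersection (or the
  differences) of these two sets cannot both satisfy their Hall conditions.\<close>
lemma minimal_feasible_single_valued:
  assumes fin: "finite Q" "finite S" and "L \<le> K" and feas: "feasible L K Q S R"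
    and minimal: "\<And>e. e \<in> R \<Longrightarrow> \<not> feasible L K Q S (R - {e})"
    and q: "(q, s) \<in> R" "(q, t) \<in> R"
  shows "s = t"
proof (rule ccontr)
  assume "s \<noteq> t"
  have R: "R \<subseteq> Q \<times> S" and up: "\<And>A. A \<subseteq> Q \<Longrightarrow> card A \<le> K * card (R `` A)"
    and lo: "\<And>B. B \<subseteq> S \<Longrightarrow> L * card B \<le> card (R\<inverse> `` B)"
    using feas unfolding feasible_def by blast+
  have finI: "finite (R' `` A)" if "R' \<subseteq> R" for A R'
    using R that by (intro finite_subset[OF _ fin(2)]) blast
  have finC: "finite (R\<inverse> `` B)" for B using R by (intro finite_subset[OF _ fin(1)]) blast
  (* One obstruction of each kind. With D the set of partners of B, the elements of A - D have partners
     only in X - B, and the elements of B - X have partners only in D - A. Adding up the two Hall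
     conditions contradicts the choice of A. *)
  have mixed: False
    if st: "(q, s) \<in> R" "(q, t) \<in> R" "s \<noteq> t"
      and A: "A \<subseteq> Q" "q \<in> A" "K * card ((R - {(q, s)}) `` A) < card A"
      and B: "B \<subseteq> S" "t \<in> B" "R `` {q} \<inter> B = {t}" "card (R\<inverse> `` B) = L * card B" for s t A B
  proof -
    define X where "X = (R - {(q, s)}) `` A"
    define D where "D = R\<inverse> `` B"
    have finX: "finite X" unfolding X_def using finI by blast
    have finD: "finite D" unfolding D_def by (rule finC)
    have finA: "finite A" "finite B"
      using finite_subset[OF A(1) fin(1)] finite_subset[OF B(1) fin(2)] by auto
    have "t \<in> X" unfolding X_def using st A by blast
    have "q \<in> D" unfolding D_def using st B by blast
    have "card (A - D) \<le> K * card (R `` (A - D))" using up A by blast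
    also have "\<dots> \<le> K * card (X - B)"
      using \<open>q \<in> D\<close> finX by (intro mult_le_mono2 card_mono) (auto simp: X_def D_def)
    finally have 1: "card (A - D) \<le> K * card (X - B)" .
    have "L * card (B - X) \<le> card (R\<inverse> `` (B - X))" using lo B by blast
    also have "\<dots> \<le> card (D - A)"
      using \<open>t \<in> X\<close> finD B(3) by (intro card_mono) (auto simp: X_def D_def)
    finally have 2: "L * card (B - X) \<le> card (D - A)" .
    have "card (A \<inter> D) + card (D - A) = L * card B"
      using B(4) card_Int_Diff[OF finD, of A] unfolding D_def by (simp add: Int_commute)
    also have "card B = card (B \<inter> X) + card (B - X)" using card_Int_Diff[OF finA(2)] .
    finally have "card (A \<inter> D) \<le> L * card (B \<inter> X)" using 2 by (simp add: distrib_left)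
    also have "\<dots> \<le> K * card (X \<inter> B)" using assms(3) by (simp add: Int_commute)
    finally have "card (A \<inter> D) + card (A - D) \<le> K * (card (X \<inter> B) + card (X - B))"
      using 1 by (simp add: distrib_left)
    then have "card A \<le> K * card X" 
      using card_Int_Diff[OF finA(1), of D] card_Int_Diff[OF finX, of B] by simp
    then show False using A(3) unfolding X_def by linarith
  qed
  note cases_s = infeasible_delete[OF fin feas q(1) minimal[OF q(1)]]
  note cases_t = infeasible_delete[OF fin feas q(2) minimal[OF q(2)]]
  show False
  proof (rule cases_s; rule cases_t)
    fix A B assume A: "A \<subseteq> Q" "q \<in> A" "K * card ((R - {(q, s)}) `` A) < card A"
      and B: "B \<subseteq> Q" "q \<in> B" "K * card ((R - {(q, t)}) `` B) < card B"
    define X Y where "X = (R - {(q, s)}) `` A" and "Y = (R - {(q, t)}) `` B"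
    have fXY: "finite X" "finite Y" unfolding X_def Y_def using finI by blast+
    have fAB: "finite A" "finite B"
      using finite_subset[OF A(1) fin(1)] finite_subset[OF B(1) fin(1)] by auto
    have "card (A \<union> B) \<le> K * card (R `` (A \<union> B))" using up A B by blast
    also have "R `` (A \<union> B) = X \<union> Y" using A B q \<open>s \<noteq> t\<close> unfolding X_def Y_def by blast
    finally have 1: "card (A \<union> B) \<le> K * card (X \<union> Y)" .
    have "R `` (A \<inter> B - {q}) \<subseteq> X \<inter> Y" unfolding X_def Y_def by blast
    moreover have "card (A \<inter> B - {q}) \<le> K * card (R `` (A \<inter> B - {q}))"
      using up[of "A \<inter> B - {q}"] A(1) by blast
    moreover have "K * card (R `` (A \<inter> B - {q})) \<le> K * card (X \<inter> Y)"
      using fXY calculation(1) by (intro mult_le_mono2 card_mono) auto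
    moreover have "card (A \<inter> B) = card (A \<inter> B - {q}) + 1"
      using A(2) B(2) fAB card_Suc_Diff1[of "A \<inter> B" q] by simp
    ultimately have "card (A \<inter> B) \<le> K * card (X \<inter> Y) + 1" by linarith
    with 1 have "card A + card B \<le> K * (card X + card Y) + 1"
      using card_Un_Int[OF fAB] card_Un_Int[OF fXY] by (simp add: distrib_left)
    then show False using A(3) B(3) unfolding X_def[symmetric] Y_def[symmetric]
      by (simp add: distrib_left)
  next
    fix A B assume "A \<subseteq> Q" "q \<in> A" "K * card ((R - {(q, s)}) `` A) < card A"
      and "B \<subseteq> S" "t \<in> B" "R `` {q} \<inter> B = {t}" "card (R\<inverse> `` B) = L * card B"
    then show False using mixed[OF q \<open>s \<noteq> t\<close>] by blast
  next
    fix A B assume "B \<subseteq> S" "s \<in> B" "R `` {q} \<inter> B = {s}" "card (R\<inverse> `` B) = L * card B"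
      and "A \<subseteq> Q" "q \<in> A" "K * card ((R - {(q, t)}) `` A) < card A"
    then show False using mixed[OF q(2,1)] \<open>s \<noteq> t\<close> by blast
  next
    fix A B assume A: "A \<subseteq> S" "s \<in> A" "R `` {q} \<inter> A = {s}" "card (R\<inverse> `` A) = L * card A"
      and B: "B \<subseteq> S" "t \<in> B" "R `` {q} \<inter> B = {t}" "card (R\<inverse> `` B) = L * card B"
    define X Y where "X = R\<inverse> `` A" and "Y = R\<inverse> `` B"
    have fXY: "finite X" "finite Y" unfolding X_def Y_def using finC by blast+
    have fAB: "finite A" "finite B"
      using finite_subset[OF A(1) fin(2)] finite_subset[OF B(1) fin(2)] by auto
    have "R\<inverse> `` (A \<union> B) = X \<union> Y" unfolding X_def Y_def by blast
    then have 1: "L * card (A \<union> B) \<le> card (X \<union> Y)" using lo[of "A \<union> B"] A B by simp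
    define Z where "Z = R\<inverse> `` (A \<inter> B)"
    have "q \<in> X" "q \<in> Y" using A(2) B(2) q unfolding X_def Y_def by blast+
    then have Z: "insert q Z \<subseteq> X \<inter> Y" unfolding X_def Y_def Z_def by blast
    have "q \<notin> Z"
    proof
      assume "q \<in> Z"
      then obtain r where "(q, r) \<in> R" "r \<in> A" "r \<in> B" unfolding Z_def by blast
      then have "r \<in> {s}" "r \<in> {t}" using A(3) B(3) by blast+
      then show False using \<open>s \<noteq> t\<close> by simp
    qed
    have "A \<inter> B \<subseteq> S" using A(1) by blast
    from lo[OF this] have "L * card (A \<inter> B) \<le> card Z" unfolding Z_def .
    moreover have "finite Z" unfolding Z_def by (rule finC)
    moreover have "card (insert q Z) \<le> card (X \<inter> Y)" using Z fXY by (intro card_mono) auto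
    ultimately have "L * card (A \<inter> B) + 1 \<le> card (X \<inter> Y)" using \<open>q \<notin> Z\<close> by simp
    with 1 have "L * (card A + card B) + 1 \<le> card X + card Y"
      using card_Un_Int[OF fAB] card_Un_Int[OF fXY] by (simp add: distrib_left)
    then show False using A(4) B(4) unfolding X_def[symmetric] Y_def[symmetric]
      by (simp add: distrib_left)
  qed
qed

text \<open>In a relation that is minimal with both Hall conditions every \<open>q\<close> has a unique partner, and the
  conditions for a single \<open>s\<close> and its fibre are the two bounds.\<close>
lemma bounded_assignment:
  assumes fin: "finite Q" "finite S" and "L \<le> K" and "feasible L K Q S R"
  obtains f where "\<And>q. q \<in> Q \<Longrightarrow> (q, f q) \<in> R"
    and "\<And>s. s \<in> S \<Longrightarrow> L \<le> card {q \<in> Q. f q = s} \<and> card {q \<in> Q. f q = s} \<le> K"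
proof -
  obtain M where M: "feasible L K Q S M" "M \<subseteq> R"
    and least: "\<And>M'. feasible L K Q S M' \<and> M' \<subseteq> R \<Longrightarrow> card M \<le> card M'"
    using ex_has_least_nat[of "\<lambda>M. feasible L K Q S M \<and> M \<subseteq> R" R card] assms(4) by blast
  have MQS: "M \<subseteq> Q \<times> S" using M unfolding feasible_def by blast
  have finM: "finite M" using MQS fin finite_subset by blast
  have "\<not> feasible L K Q S (M - {e})" if "e \<in> M" for e
    using least[of "M - {e}"] M(2) card_Diff1_less[OF finM that] by fastforce
  then have single: "s = t" if "(q, s) \<in> M" "(q, t) \<in> M" for q s t
    using minimal_feasible_single_valued[OF fin assms(3) M(1)] that by blast
  have "\<exists>s. (q, s) \<in> M" if "q \<in> Q" for q
  proof (rule ccontr)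
    assume "\<nexists>s. (q, s) \<in> M"
    then have "M `` {q} = {}" by blast
    moreover have "card {q} \<le> K * card (M `` {q})" using M that unfolding feasible_def by blast
    ultimately show False by simp
  qed
  then obtain f where f: "\<And>q. q \<in> Q \<Longrightarrow> (q, f q) \<in> M" by metis
  have fib: "{q \<in> Q. f q = s} = M\<inverse> `` {s}" for s using f single MQS by blast
  show thesis
  proof (rule that)
    fix s assume "s \<in> S"
    then have "{s} \<subseteq> S" "M\<inverse> `` {s} \<subseteq> Q" using MQS by blast+
    then have "L * card {s} \<le> card (M\<inverse> `` {s})"
      "card (M\<inverse> `` {s}) \<le> K * card (M `` (M\<inverse> `` {s}))"
      using M(1) unfolding feasible_def by meson+
    moreover have "M `` (M\<inverse> `` {s}) \<subseteq> {s}"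
    proof
      fix t assume "t \<in> M `` (M\<inverse> `` {s})"
      then obtain q where "(q, s) \<in> M" "(q, t) \<in> M" by blast
      then show "t \<in> {s}" using single[of q s t] by simp
    qed
    then have "card (M `` (M\<inverse> `` {s})) \<le> 1"
      using card_mono[of "{s}" "M `` (M\<inverse> `` {s})"] by simp
    then have "K * card (M `` (M\<inverse> `` {s})) \<le> K * 1" by (rule mult_le_mono2)
    ultimately have "L * card {s} \<le> card (M\<inverse> `` {s})" "card (M\<inverse> `` {s}) \<le> K * 1"
      by (blast intro: order_trans)+
    then show "L \<le> card {q \<in> Q. f q = s} \<and> card {q \<in> Q. f q = s} \<le> K"
      unfolding fib by simp
  qed (use f M in blast)
qed

section \<open>Vertex sets of maximal surplus and their components\<close>

text \<open>The surplus of \<open>S\<close> is \<open>oc E (V - S) - m * card S\<close>, and \<open>S\<close> is required to be inclusion-maximal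
  among the sets of maximal surplus. The inequalities have sums on both sides to avoid truncated
  subtraction.\<close>
definition max_surplus :: "nat \<Rightarrow> 'a rel \<Rightarrow> 'a set \<Rightarrow> 'a set \<Rightarrow> bool" where
  "max_surplus m E V S \<longleftrightarrow> S \<subseteq> V \<and>
     (\<forall>T \<subseteq> V. oc E (V - T) + m * card S \<le> oc E (V - S) + m * card T) \<and>
     (\<forall>T \<subseteq> V. S \<subset> T \<longrightarrow> oc E (V - T) + m * card S < oc E (V - S) + m * card T)"

definition odd_factor :: "nat \<Rightarrow> 'a rel \<Rightarrow> 'a set \<Rightarrow> 'a rel \<Rightarrow> bool" where
  "odd_factor m E V F \<longleftrightarrow> F \<subseteq> E \<inter> V \<times> V \<and> sym F \<and>
     (\<forall>v \<in> V. odd (card (F `` {v})) \<and> card (F `` {v}) \<le> m)"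

text \<open>Choose a set of largest cardinality among those of maximal surplus.\<close>
lemma max_surplus_exists:
  assumes "finite V"
  obtains S where "max_surplus m E V S"
proof -
  define k where "k T = oc E (V - T) + m * card (V - T)" for T
  have k: "k T + m * card T = oc E (V - T) + m * card V" if "T \<subseteq> V" for T
  proof -
    have "card (V - T) + card T = card V"
      using that assms finite_subset[OF that assms] by (simp add: card_Diff_subset card_mono)
    then show ?thesis unfolding k_def by (metis add.assoc distrib_left)
  qed
  let ?M = "Max (k ` Pow V)"
  have M: "k T \<le> ?M" if "T \<subseteq> V" for T using that assms by simp
  have "?M \<in> k ` Pow V" using assms by (intro Max_in) auto
  then obtain T0 where "T0 \<subseteq> V" "k T0 = ?M" by (metis imageE PowD)
  then obtain S where S: "S \<subseteq> V" "k S = ?M"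
    and greatest: "\<And>T. T \<subseteq> V \<and> k T = ?M \<Longrightarrow> card T \<le> card S"
    using ex_has_greatest_nat[of "\<lambda>T. T \<subseteq> V \<and> k T = ?M" T0 card "Suc (card V)"]
      card_mono[OF assms] by (metis le_imp_less_Suc)
  have strict: "k T < ?M" if "T \<subseteq> V" "S \<subset> T" for T
  proof -
    have "card S < card T" using that assms finite_subset by (metis psubset_card_mono)
    then have "k T \<noteq> ?M" using greatest[of T] that(1) by linarith
    then show ?thesis using M[OF that(1)] by simp
  qed
  have "max_surplus m E V S"
    unfolding max_surplus_def
  proof (intro conjI allI impI)
    show "oc E (V - T) + m * card S \<le> oc E (V - S) + m * card T" if "T \<subseteq> V" for T
      using k[OF that] k[OF S(1)] M[OF that] S(2) by linarith
    show "oc E (V - T) + m * card S < oc E (V - S) + m * card T" if "T \<subseteq> V" "S \<subset> T" for T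
      using k[OF that(1)] k[OF S(1)] strict[OF that] S(2) by linarith
  qed (fact S)
  with that show thesis .
qed

text \<open>Enlarging \<open>S\<close> by a nonempty part of a component lowers the surplus. This bounds the number of odd
  components that such a part can cut off.\<close>
lemma max_surplus_component:
  assumes "finite V" "max_surplus m E V S" "C \<in> comps E (V - S)" "T \<subseteq> C" "T \<noteq> {}"
  shows "oc E (C - T) < m * card T + (if odd (card C) then 1 else 0)"
proof -
  have S: "S \<subseteq> V" and C: "C \<subseteq> V - S"
    using assms(2) compsD(1)[OF assms(3)] unfolding max_surplus_def by auto
  have fin: "finite S" "finite T" "finite (V - S)"
    using finite_subset[OF S assms(1)] finite_subset[of T V] S C assms(1,4) by auto
  have "S \<union> T \<subseteq> V" "S \<subset> S \<union> T" using S C assms(4,5) by blast+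
  then have "oc E (V - (S \<union> T)) + m * card S < oc E (V - S) + m * card (S \<union> T)"
    using assms(2) unfolding max_surplus_def by blast
  moreover have "S \<inter> T = {}" using C assms(4) by blast
  then have "card (S \<union> T) = card S + card T" using fin card_Un_disjoint by blast
  moreover have "V - (S \<union> T) = V - S - T" by blast
  ultimately have lt: "oc E (V - S - T) < oc E (V - S) + m * card T" by (simp add: distrib_left)
  have le: "card (odd_comps E (V - S) - {C}) + oc E (C - T) \<le> oc E (V - S - T)"
    by (rule oc_delete_in_component[OF fin(3) assms(3,4)])
  show ?thesis
  proof (cases "odd (card C)")
    case True
    then have "C \<in> odd_comps E (V - S)" using assms(3) unfolding odd_comps_def by blast
    then have "oc E (V - S) = card (odd_comps E (V - S) - {C}) + 1"
      using finite_odd_comps[OF fin(3)] card_Suc_Diff1[of "odd_comps E (V - S)" C] by simp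
    then show ?thesis using lt le True by simp
  next
    case False
    then have "odd_comps E (V - S) - {C} = odd_comps E (V - S)" unfolding odd_comps_def by blast
    then show ?thesis using lt le False by simp
  qed
qed

lemma oc_linked:
  assumes "linked E C"
  shows "oc E C = (if odd (card C) then 1 else 0)"
proof -
  have "odd_comps E C = (if odd (card C) then {C} else {})"
    using comps_self[OF assms] unfolding odd_comps_def by auto
  then show ?thesis by simp
qed

lemma even_component_hypothesis:
  assumes "finite V" "max_surplus m E V S" "C \<in> comps E (V - S)" "even (card C)" "T \<subseteq> C"
  shows "oc E (C - T) \<le> m * card T"
proof (cases "T = {}")
  case True
  then show ?thesis using oc_linked[OF compsD(2)[OF assms(3)]] assms(4) by simp
next
  case False
  then show ?thesis using max_surplus_component[OF assms(1-3,5) False] assms(4) by simp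
qed

text \<open>Attaching the edge from \<open>c \<in> C\<close> to \<open>s \<in> S\<close> makes \<open>s\<close> a pendant vertex of the component. It can
  raise the number of odd components by one, and this is made up for by parity: as \<open>card C\<close> is odd,
  the number of odd components of \<open>C - T\<close> has the parity of \<open>card T + 1\<close>, so it cannot be equal to
  \<open>m * card T\<close>.\<close>
lemma odd_component_hypothesis:
  assumes "finite V" "sym E" "odd m" "max_surplus m E V S"
    and C: "C \<in> odd_comps E (V - S)" and s: "s \<in> S" "c \<in> C" "(s, c) \<in> E"
    and T: "T \<subseteq> insert s C"
  shows "oc (E \<inter> C \<times> C \<union> {(s, c), (c, s)}) (insert s C - T) \<le> m * card T"
proof -
  let ?E = "E \<inter> C \<times> C \<union> {(s, c), (c, s)}"
  have Cc: "C \<in> comps E (V - S)" "odd (card C)" using C unfolding odd_comps_def by auto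
  have CV: "C \<subseteq> V - S" using compsD(1)[OF Cc(1)] .
  have finC: "finite C" using finite_subset[OF CV] assms(1) by simp
  have sC: "s \<notin> C" using CV s by blast
  have same: "oc ?E (C - T) = oc E (C - T)" for T using sC by (intro oc_Restr) blast
  have small: "oc E (C - T) + 1 \<le> m * card T" if "T \<subseteq> C" "T \<noteq> {}" for T
  proof -
    have "finite T" "card T \<le> card C"
      using finite_subset[OF that(1) finC] card_mono[OF finC that(1)] by auto
    then have "even (oc E (C - T)) \<longleftrightarrow> even (card C - card T)"
      using oc_parity[of "C - T" E] assms(2) finC that by (simp add: card_Diff_subset)
    then have "oc E (C - T) \<noteq> m * card T"
      using \<open>card T \<le> card C\<close> Cc(2) assms(3) by (auto simp: even_diff_nat)
    moreover have "oc E (C - T) < m * card T + 1"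
      using max_surplus_component[OF assms(1,4) Cc(1) that] Cc(2) by simp
    ultimately show ?thesis by linarith
  qed
  have finT: "finite T" using finite_subset[OF T] finC by simp
  consider "s \<in> T" | "s \<notin> T" "T \<noteq> {}" | "T = {}" by blast
  then show ?thesis
  proof cases
    case 1
    define U where "U = T - {s}"
    have "U \<subseteq> C" "insert s C - T = C - U" using 1 T sC unfolding U_def by blast+
    moreover have "card T = Suc (card U)" using card_Suc_Diff1[OF finT 1] unfolding U_def by simp
    moreover have "oc E (C - U) \<le> m * Suc (card U)"
    proof (cases "U = {}")
      case True
      have "m > 0" using assms(3) by (rule odd_pos)
      then show ?thesis using True oc_linked[OF compsD(2)[OF Cc(1)]] Cc(2) by simp
    qed (use small[of U] \<open>U \<subseteq> C\<close> in simp)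
    ultimately show ?thesis using same by simp
  next
    case 2
    then have "T \<subseteq> C" "insert s C - T = insert s (C - T)" using T by blast+
    then show ?thesis
      using oc_insert[of "C - T" ?E s] same[of T] small[of T] 2 finC by simp
  next
    case 3
    have "False" if X: "X \<in> odd_comps ?E (insert s C)" for X
    proof -
      have Xc: "X \<subseteq> insert s C" "X \<noteq> {}" "sealed ?E (insert s C) X" "odd (card X)"
        using X unfolding odd_comps_def comps_def linked_def by auto
      have "linked ?E C" using compsD(2)[OF Cc(1)] by (rule linked_mono) blast
      have "s \<in> X"
      proof (cases "X \<inter> C = {}")
        case True
        then show ?thesis using Xc(1,2) by blast
      next
        case False
        then have "C \<subseteq> X"
          using linked_subset_sealed[OF \<open>linked ?E C\<close> _ Xc(3)] by blast
        then show ?thesis using sealedD[OF Xc(3), of c s] s by blast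
      qed
      then have "c \<in> X" using sealedD[OF Xc(3), of s c] s by blast
      then have "C \<subseteq> X"
        using linked_subset_sealed[OF \<open>linked ?E C\<close> _ Xc(3)] s by blast
      then have "X = insert s C" using Xc(1) \<open>s \<in> X\<close> by blast
      then show False using Xc(4) Cc(2) sC finC by simp
    qed
    then have "odd_comps ?E (insert s C) = {}" by blast
    then show ?thesis using 3 by simp
  qed
qed

section \<open>Gluing factors of the components\<close>

text \<open>A set \<open>A\<close> of odd components whose only neighbours in \<open>S\<close> are the elements of \<open>N\<close> consists of
  components of \<open>V - N\<close>, so the hypothesis for \<open>N\<close> bounds \<open>card A\<close>. The odd components without
  neighbours in \<open>B\<close> are still components of \<open>V - (S - B)\<close>, so if the others were fewer than
  \<open>m * card B\<close>, then \<open>S - B\<close> would have larger surplus than \<open>S\<close>.\<close>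
lemma surplus_feasible:
  assumes "finite V" "sym E" "max_surplus m E V S"
    and hyp: "\<And>T. T \<subseteq> V \<Longrightarrow> oc E (V - T) \<le> K * card T"
  shows "feasible m K (odd_comps E (V - S)) S
    {(C, s). C \<in> odd_comps E (V - S) \<and> s \<in> S \<and> (\<exists>c \<in> C. (s, c) \<in> E)}"
    (is "feasible m K ?Q S ?R")
  unfolding feasible_def
proof (intro conjI allI impI)
  have S: "S \<subseteq> V" using assms(3) unfolding max_surplus_def by blast
  then have finS: "finite S" using assms(1) by (rule finite_subset)
  show "?R \<subseteq> ?Q \<times> S" by blast
  show "card A \<le> K * card (?R `` A)" if A: "A \<subseteq> ?Q" for A
  proof -
    let ?N = "?R `` A"
    have "A \<subseteq> odd_comps E (V - ?N)"
    proof
      fix C assume "C \<in> A"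
      then have C: "C \<in> ?Q" "C \<subseteq> V - S" "linked E C" "sealed E (V - S) C" "odd (card C)"
        using A unfolding odd_comps_def comps_def by auto
      have "sealed E (V - ?N) C"
        unfolding sealed_def
      proof (intro allI impI)
        fix a b assume ab: "(a, b) \<in> E" "a \<in> C" "b \<in> V - ?N"
        have "b \<notin> S"
        proof
          assume "b \<in> S"
          then have "(C, b) \<in> ?R" using ab C(1) symD[OF assms(2)] by blast
          then show False using ab(3) \<open>C \<in> A\<close> by blast
        qed
        then show "b \<in> C" using sealedD[OF C(4) ab(1,2)] ab(3) by blast
      qed
      moreover have "C \<subseteq> V - ?N" using C(2) by blast
      ultimately show "C \<in> odd_comps E (V - ?N)"
        using C unfolding odd_comps_def comps_def by blast
    qed
    then have "card A \<le> oc E (V - ?N)"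
      using card_mono[OF finite_odd_comps[of "V - ?N"]] assms(1) by blast
    moreover have "?N \<subseteq> V" using S by blast
    then have "oc E (V - ?N) \<le> K * card ?N" by (rule hyp)
    ultimately show ?thesis by (rule order_trans)
  qed
  show "m * card B \<le> card (?R\<inverse> `` B)" if B: "B \<subseteq> S" for B
  proof -
    let ?N = "?R\<inverse> `` B"
    have finQ: "finite ?Q" using assms(1) finite_odd_comps by blast
    have "?Q - ?N \<subseteq> odd_comps E (V - (S - B))"
    proof
      fix C assume C: "C \<in> ?Q - ?N"
      then have C': "C \<subseteq> V - S" "linked E C" "sealed E (V - S) C" "odd (card C)"
        unfolding odd_comps_def comps_def by auto
      have "sealed E (V - (S - B)) C"
        unfolding sealed_def
      proof (intro allI impI)
        fix a b assume ab: "(a, b) \<in> E" "a \<in> C" "b \<in> V - (S - B)"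
        have "b \<notin> B"
        proof
          assume "b \<in> B"
          then have "(C, b) \<in> ?R" using ab C B symD[OF assms(2)] by blast
          then show False using C \<open>b \<in> B\<close> by blast
        qed
        then show "b \<in> C" using sealedD[OF C'(3) ab(1,2)] ab(3) by blast
      qed
      moreover have "C \<subseteq> V - (S - B)" using C' by blast
      ultimately show "C \<in> odd_comps E (V - (S - B))"
        using C' unfolding odd_comps_def comps_def by blast
    qed
    then have "card (?Q - ?N) \<le> oc E (V - (S - B))"
      using card_mono[OF finite_odd_comps[of "V - (S - B)"]] assms(1) by blast
    moreover have "?N \<subseteq> ?Q" by blast
    then have "card ?Q = card (?Q - ?N) + card ?N"
      using finQ card_Diff_subset[of ?N ?Q] card_mono[of ?Q ?N] finite_subset[of ?N ?Q] by simp
    moreover have "S - B \<subseteq> V" using S by blast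
    then have "oc E (V - (S - B)) + m * card S \<le> oc E (V - S) + m * card (S - B)"
      using assms(3) unfolding max_surplus_def by blast
    moreover have "card S = card (S - B) + card B"
      using finS B card_Diff_subset[of B S] card_mono[of S B] finite_subset[of B S] by simp
    then have "m * card S = m * card (S - B) + m * card B" by (simp add: distrib_left)
    ultimately show ?thesis by linarith
  qed
qed

text \<open>Every odd component \<open>C\<close> is joined by one edge to its representative \<open>s\<close> in \<open>S\<close>: in a factor of
  \<open>C\<close> with that edge attached, \<open>s\<close> has odd degree and only one possible neighbour, so the edge is
  used. In the union of the factors the degree of \<open>s\<close> is therefore the number of components that it
  represents, and all other degrees are those in the factors.\<close>
lemma glue_factors:
  assumes "finite V" "sym E" "m \<le> K" "max_surplus m E V S"
    and hyp: "\<And>T. T \<subseteq> V \<Longrightarrow> oc E (V - T) \<le> K * card T"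
    and odds: "\<And>C s c. \<lbrakk>C \<in> odd_comps E (V - S); s \<in> S; c \<in> C; (s, c) \<in> E\<rbrakk> \<Longrightarrow>
      \<exists>F. odd_factor m (E \<inter> C \<times> C \<union> {(s, c), (c, s)}) (insert s C) F"
    and evens: "\<And>C. \<lbrakk>C \<in> comps E (V - S); even (card C)\<rbrakk> \<Longrightarrow> \<exists>F. odd_factor m E C F"
  obtains F where "F \<subseteq> E \<inter> V \<times> V" "sym F"
    and "\<And>v. v \<in> V - S \<Longrightarrow> odd (card (F `` {v})) \<and> card (F `` {v}) \<le> m"
    and "\<And>v. v \<in> S \<Longrightarrow> m \<le> card (F `` {v}) \<and> card (F `` {v}) \<le> K"
proof -
  define Q where "Q = odd_comps E (V - S)"
  have S: "S \<subseteq> V" using assms(4) unfolding max_surplus_def by blast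
  then have finS: "finite S" using assms(1) by (rule finite_subset)
  have finQ: "finite Q" using assms(1) finite_odd_comps unfolding Q_def by blast
  have Qc: "Q \<subseteq> comps E (V - S)" unfolding Q_def by (rule odd_comps_sub)
  define R where "R = {(C, s). C \<in> Q \<and> s \<in> S \<and> (\<exists>c \<in> C. (s, c) \<in> E)}"
  have "feasible m K Q S R"
    unfolding Q_def R_def by (rule surplus_feasible[OF assms(1,2,4) hyp])
  then obtain f where "\<And>C. C \<in> Q \<Longrightarrow> (C, f C) \<in> R"
    and bounds: "\<And>s. s \<in> S \<Longrightarrow> m \<le> card {C \<in> Q. f C = s} \<and> card {C \<in> Q. f C = s} \<le> K"
    by (rule bounded_assignment[OF finQ finS assms(3)]) blast
  then have f: "f C \<in> S \<and> (\<exists>c \<in> C. (f C, c) \<in> E)" if "C \<in> Q" for C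
    using that unfolding R_def by blast
  have fS: "f C \<in> S" if "C \<in> Q" for C using f[OF that] by blast
  have "\<exists>F c. F \<subseteq> E \<and> sym F \<and> (\<forall>v \<in> C. odd (card (F `` {v})) \<and> card (F `` {v}) \<le> m) \<and>
      (if C \<in> Q then F \<subseteq> insert (f C) C \<times> insert (f C) C \<and> c \<in> C \<and> F `` {f C} = {c}
       else F \<subseteq> C \<times> C)" if C: "C \<in> comps E (V - S)" for C
  proof (cases "C \<in> Q")
    case True
    then obtain c where c: "c \<in> C" "(f C, c) \<in> E" using f by blast
    obtain F where F: "odd_factor m (E \<inter> C \<times> C \<union> {(f C, c), (c, f C)}) (insert (f C) C) F"
      using odds[of C "f C" c] True c fS unfolding Q_def by blast
    have "f C \<notin> C" using fS[OF True] compsD(1)[OF C] by blast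
    then have "F `` {f C} \<subseteq> {c}" using F unfolding odd_factor_def by blast
    moreover have "odd (card (F `` {f C}))" using F unfolding odd_factor_def by blast
    then have "F `` {f C} \<noteq> {}" by (metis card.empty even_zero)
    ultimately have "F `` {f C} = {c}" by blast
    moreover have "F \<subseteq> E" using F c symD[OF assms(2)] unfolding odd_factor_def by blast
    moreover have "F \<subseteq> insert (f C) C \<times> insert (f C) C" "sym F"
      "\<forall>v \<in> C. odd (card (F `` {v})) \<and> card (F `` {v}) \<le> m"
      using F unfolding odd_factor_def by blast+
    ultimately have "F \<subseteq> E \<and> sym F \<and> (\<forall>v \<in> C. odd (card (F `` {v})) \<and> card (F `` {v}) \<le> m) \<and>
      F \<subseteq> insert (f C) C \<times> insert (f C) C \<and> c \<in> C \<and> F `` {f C} = {c}"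
      using c(1) by (intro conjI)
    then show ?thesis using True by auto
  next
    case False
    then have "even (card C)" using C unfolding Q_def odd_comps_def by blast
    then obtain F where "odd_factor m E C F" using evens C by blast
    then show ?thesis using False unfolding odd_factor_def by auto
  qed
  then obtain G c where G: "\<And>C. C \<in> comps E (V - S) \<Longrightarrow> G C \<subseteq> E \<and> sym (G C) \<and>
      (\<forall>v \<in> C. odd (card (G C `` {v})) \<and> card (G C `` {v}) \<le> m) \<and>
      (if C \<in> Q then G C \<subseteq> insert (f C) C \<times> insert (f C) C \<and> c C \<in> C \<and> G C `` {f C} = {c C}
       else G C \<subseteq> C \<times> C)" by metis
  define F where "F = (\<Union>C \<in> comps E (V - S). G C)"
  have support: "v \<in> C \<or> C \<in> Q \<and> v = f C" if "C \<in> comps E (V - S)" "(v, w) \<in> G C" for C v w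
    using G[OF that(1)] that(2) by (auto split: if_splits)
  have symG: "(w, v) \<in> G C" if "C \<in> comps E (V - S)" "(v, w) \<in> G C" for C v w
    using G[OF that(1)] that(2) unfolding sym_def by blast
  have inV: "v \<in> V" if "C \<in> comps E (V - S)" "(v, w) \<in> G C" for C v w
    using support[OF that] compsD(1)[OF that(1)] fS S by blast
  show thesis
  proof (rule that)
    show "F \<subseteq> E \<inter> V \<times> V"
    proof (rule subrelI)
      fix v w assume "(v, w) \<in> F"
      then obtain C where C: "C \<in> comps E (V - S)" "(v, w) \<in> G C" unfolding F_def by blast
      then show "(v, w) \<in> E \<inter> V \<times> V"
        using G[OF C(1)] inV[OF C] inV[OF C(1) symG[OF C]] by blast
    qed
    show "sym F" using symG unfolding F_def sym_def by blast
    show "odd (card (F `` {v})) \<and> card (F `` {v}) \<le> m" if v: "v \<in> V - S" for v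
    proof -
      obtain C where C: "C \<in> comps E (V - S)" "v \<in> C"
        using comps_cover[OF _ assms(2) v] assms(1) by blast
      have "D = C" if D: "D \<in> comps E (V - S)" "(v, w) \<in> G D" for D w
      proof -
        have "v \<in> D" using support[OF D] fS v by blast
        then show ?thesis using comps_eq[OF D(1) C(1)] C(2) by blast
      qed
      then have "F `` {v} = G C `` {v}" using C(1) unfolding F_def by blast
      then show ?thesis using G[OF C(1)] C(2) by simp
    qed
    show "m \<le> card (F `` {s}) \<and> card (F `` {s}) \<le> K" if s: "s \<in> S" for s
    proof -
      have "F `` {s} = c ` {C \<in> Q. f C = s}"
      proof (intro set_eqI iffI)
        fix w assume "w \<in> F `` {s}"
        then obtain C where C: "C \<in> comps E (V - S)" "(s, w) \<in> G C" unfolding F_def by blast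
        then have "C \<in> Q" "s = f C" using support[OF C] compsD(1)[OF C(1)] s by blast+
        moreover from this have "w = c C" using G[OF C(1)] C(2) by auto
        ultimately show "w \<in> c ` {C \<in> Q. f C = s}" by blast
      next
        fix w assume "w \<in> c ` {C \<in> Q. f C = s}"
        then obtain C where C: "C \<in> Q" "f C = s" "w = c C" by blast
        then have "C \<in> comps E (V - S)" using Qc by blast
        moreover from G[OF this] C have "(s, w) \<in> G C" by auto
        ultimately show "w \<in> F `` {s}" unfolding F_def by blast
      qed
      moreover have "inj_on c {C \<in> Q. f C = s}"
      proof (rule inj_onI)
        fix C D assume "C \<in> {C \<in> Q. f C = s}" "D \<in> {C \<in> Q. f C = s}" "c C = c D"
        then have CD: "C \<in> Q" "D \<in> Q" "c C = c D" by auto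
        then have "C \<in> comps E (V - S)" "D \<in> comps E (V - S)" using Qc by blast+
        moreover from this have "c C \<in> C" "c D \<in> D" using G[of C] G[of D] CD by auto
        ultimately show "C = D" using comps_eq[of C E "V - S" D] CD(3) by auto
      qed
      ultimately show ?thesis using bounds[OF s] by (simp add: card_image)
    qed
  qed
qed

section \<open>Factors with bounded odd degrees\<close>

text \<open>If deleting any edge produces odd components, then every edge is a bridge with odd sides. The
  neighbours of \<open>v\<close> then lie in different components of \<open>V - {v}\<close>, and these components are all odd
  components there, so the degree of \<open>v\<close> is their number.\<close>
lemma all_odd_bridges_degree:
  assumes "finite V" "sym E" "oc E V = 0" and v: "v \<in> V"
    and bridges: "\<And>x y. (x, y) \<in> E \<Longrightarrow> oc (E - {(x, y), (y, x)}) V \<noteq> 0"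
  shows "card (E `` {v}) = oc E (V - {v})"
proof -
  have noodd: "odd_comps E V = {}" using assms(3) finite_odd_comps[OF assms(1), of E] by simp
  have evenV: "even (card V)" using oc_parity[OF assms(1,2)] assms(3) by simp
  have branch: "\<exists>X \<in> odd_comps E (V - {v}). w \<in> X \<and> E `` {v} \<inter> X = {w}" if "(v, w) \<in> E" for w
  proof -
    let ?E = "E - {(v, w), (w, v)}"
    have symE': "sym ?E" using assms(2) unfolding sym_def by blast
    have fin: "finite (odd_comps ?E V)" using assms(1) by (rule finite_odd_comps)
    have split: "\<not> (v \<notin> X \<and> w \<notin> X \<or> v \<in> X \<and> w \<in> X)" if "X \<in> odd_comps ?E V" for X
      using that comps_delete_edge[of X E v w V] noodd unfolding odd_comps_def by blast
    (* The number of odd components is even and positive, so there are two of them. *)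
    have "oc ?E V \<noteq> 0" "even (oc ?E V)"
      using bridges[OF that] oc_parity[OF assms(1) symE'] evenV by auto
    then have "\<not> oc ?E V \<le> Suc 0" by (auto simp: le_Suc_eq)
    then obtain X Y where XY: "X \<in> odd_comps ?E V" "Y \<in> odd_comps ?E V" "X \<noteq> Y"
      using card_le_Suc0_iff_eq[OF fin] by blast
    then have "X \<inter> Y = {}" using comps_eq odd_comps_sub by blast
    then obtain Z where Z: "Z \<in> odd_comps ?E V" "w \<in> Z" "v \<notin> Z"
      using split[OF XY(1)] split[OF XY(2)] XY(1,2) by blast
    then have Zc: "Z \<subseteq> V" "linked ?E Z" "sealed ?E V Z" "odd (card Z)"
      unfolding odd_comps_def comps_def by auto
    have "linked E Z" using Zc(2) by (rule linked_mono) blast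
    moreover have "sealed E (V - {v}) Z" using Zc(3) Z(3) unfolding sealed_def by blast
    ultimately have "Z \<in> odd_comps E (V - {v})"
      using Zc(1,4) Z(3) unfolding odd_comps_def comps_def by blast
    moreover have "E `` {v} \<inter> Z \<subseteq> {w}"
    proof
      fix u assume u: "u \<in> E `` {v} \<inter> Z"
      show "u \<in> {w}"
      proof (rule ccontr)
        assume "u \<notin> {w}"
        then have "(u, v) \<in> ?E" using u Z(3) symD[OF assms(2), of v u] by blast
        then show False using sealedD[OF Zc(3), of u v] u v Z(3) by blast
      qed
    qed
    ultimately show ?thesis using that Z(2) by blast
  qed
  then obtain B where B: "\<And>w. (v, w) \<in> E \<Longrightarrow>
      B w \<in> odd_comps E (V - {v}) \<and> w \<in> B w \<and> E `` {v} \<inter> B w = {w}" by metis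
  have "bij_betw B (E `` {v}) (odd_comps E (V - {v}))"
    unfolding bij_betw_def
  proof (intro conjI inj_onI equalityI subsetI)
    fix w u assume "w \<in> E `` {v}" "u \<in> E `` {v}" "B w = B u"
    then have "u \<in> E `` {v} \<inter> B w" using B[of u] by simp
    then have "u \<in> {w}" using B[of w] \<open>w \<in> E `` {v}\<close> by blast
    then show "w = u" by simp
  next
    fix X assume "X \<in> B ` (E `` {v})"
    then show "X \<in> odd_comps E (V - {v})" using B by blast
  next
    fix X assume X: "X \<in> odd_comps E (V - {v})"
    then have Xc: "X \<subseteq> V - {v}" "linked E X" "sealed E (V - {v}) X" "odd (card X)"
      unfolding odd_comps_def comps_def by auto
    have "E `` {v} \<inter> X \<noteq> {}"
    proof
      assume none: "E `` {v} \<inter> X = {}"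
      have "sealed E V X"
        unfolding sealed_def
      proof (intro allI impI)
        fix a b assume ab: "(a, b) \<in> E" "a \<in> X" "b \<in> V"
        have "b \<noteq> v" using none ab(1,2) symD[OF assms(2), of a b] by blast
        then show "b \<in> X" using sealedD[OF Xc(3) ab(1,2)] ab(3) by blast
      qed
      then have "X \<in> odd_comps E V" using Xc unfolding odd_comps_def comps_def by blast
      then show False using noodd by blast
    qed
    then obtain w where w: "(v, w) \<in> E" "w \<in> X" by blast
    have "B w = X"
      using B[OF w(1)] w(2) X odd_comps_sub[of E "V - {v}"] comps_eq[of "B w" E "V - {v}" X] by blast
    then show "X \<in> B ` (E `` {v})" using w(1) by blast
  qed
  then show ?thesis by (rule bij_betw_same_card)
qed

text \<open>This is Amahashi's theorem on odd factors. The induction step distinguishes whether the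
  hypothesis is tight for some nonempty set. If it is, the components left by a set of maximal surplus
  are smaller graphs, and \<open>m \<ge> 3\<close> ensures that an odd component stays smaller when an element of the
  set is added. If it is not, parity gives a slack of two, which any edge deletion respects unless it
  creates odd components in the whole graph.\<close>
theorem odd_factor_exists:
  fixes V :: "'a set"
  assumes "finite V" "finite E" "sym E" "odd m" "m \<ge> 3"
    and "\<And>T. T \<subseteq> V \<Longrightarrow> oc E (V - T) \<le> m * card T"
  shows "\<exists>F. odd_factor m E V F"
  using assms
proof (induction "card V + card E" arbitrary: V E rule: less_induct)
  case less
  note hyp = less.prems(6)
  have oc0: "oc E V = 0" using hyp[of "{}"] by simp
  then have evenV: "even (card V)" using oc_parity[OF less.prems(1,3)] by simp
  show ?case
  proof (cases "\<exists>T \<subseteq> V. T \<noteq> {} \<and> oc E (V - T) = m * card T")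
    case True
    then obtain T where T: "T \<subseteq> V" "T \<noteq> {}" "oc E (V - T) = m * card T" by blast
    obtain S where S: "max_surplus m E V S" using max_surplus_exists[OF less.prems(1)] by blast
    then have SV: "S \<subseteq> V" unfolding max_surplus_def by blast
    have "S \<noteq> {}"
    proof
      assume "S = {}"
      then have "oc E (V - T) + m * card ({} :: 'a set) < oc E (V - {}) + m * card T"
        using S T(1,2) unfolding max_surplus_def by blast
      then show False using T(3) oc0 by simp
    qed
    have finS: "finite S" using SV less.prems(1) by (rule finite_subset)
    have "oc E V + m * card S \<le> oc E (V - S)"
    proof -
      have "oc E (V - {}) + m * card S \<le> oc E (V - S) + m * card ({} :: 'a set)"
        using S unfolding max_surplus_def by blast
      then show ?thesis by simp
    qed
    moreover have "card S \<ge> 1" using finS \<open>S \<noteq> {}\<close> by (simp add: Suc_le_eq card_gt_0_iff)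
    then have "m * card S \<ge> 3 * 1" using less.prems(5) by (intro mult_le_mono)
    ultimately have many: "oc E (V - S) \<ge> 3" by linarith
    have odds: "\<exists>F. odd_factor m (E \<inter> C \<times> C \<union> {(s, c), (c, s)}) (insert s C) F"
      if C: "C \<in> odd_comps E (V - S)" and s: "s \<in> S" "c \<in> C" "(s, c) \<in> E" for C s c
    proof (rule less.hyps)
      let ?E = "E \<inter> C \<times> C \<union> {(s, c), (c, s)}"
      have Cc: "C \<in> comps E (V - S)" using C odd_comps_sub by blast
      have CV: "C \<subseteq> V - S" by (rule compsD(1)[OF Cc])
      have "\<not> odd_comps E (V - S) \<subseteq> {C}"
      proof
        assume "odd_comps E (V - S) \<subseteq> {C}"
        then have "oc E (V - S) \<le> card {C}" by (intro card_mono) auto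
        then show False using many by simp
      qed
      then obtain D where "D \<in> odd_comps E (V - S)" "D \<noteq> C" by blast
      then have D: "D \<in> comps E (V - S)" "D \<noteq> C" unfolding odd_comps_def by auto
      have "D \<inter> C = {}" using comps_eq[OF D(1) Cc] D(2) by metis
      then have "insert s C \<subset> V" using CV s(1) SV compsD(1,4)[OF D(1)] by blast
      then have "card (insert s C) < card V" by (rule psubset_card_mono[OF less.prems(1)])
      moreover have subE: "?E \<subseteq> E" using s symD[OF less.prems(3)] by blast
      then have "card ?E \<le> card E" by (rule card_mono[OF less.prems(2)])
      ultimately show "card (insert s C) + card ?E < card V + card E" by linarith
      show "finite (insert s C)" using CV less.prems(1) finite_subset[of C V] by auto
      show "finite ?E" using subE less.prems(2) by (rule finite_subset)
      show "sym ?E" using less.prems(3) unfolding sym_def by blast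
      show "oc ?E (insert s C - T) \<le> m * card T" if "T \<subseteq> insert s C" for T
        by (rule odd_component_hypothesis[OF less.prems(1,3,4) S C s that])
    qed (use less.prems in auto)
    have evens: "\<exists>F. odd_factor m E C F"
      if C: "C \<in> comps E (V - S)" "even (card C)" for C
    proof (rule less.hyps)
      have "C \<subset> V" using compsD(1)[OF C(1)] SV \<open>S \<noteq> {}\<close> by blast
      then show "card C + card E < card V + card E"
        using psubset_card_mono[OF less.prems(1)] by simp
      show "finite C" using \<open>C \<subset> V\<close> less.prems(1) finite_subset[of C V] by auto
      show "oc E (C - T) \<le> m * card T" if "T \<subseteq> C" for T
        by (rule even_component_hypothesis[OF less.prems(1) S C that])
    qed (use less.prems in auto)
    obtain F where F: "F \<subseteq> E \<inter> V \<times> V" "sym F"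
      "\<And>v. v \<in> V - S \<Longrightarrow> odd (card (F `` {v})) \<and> card (F `` {v}) \<le> m"
      "\<And>v. v \<in> S \<Longrightarrow> m \<le> card (F `` {v}) \<and> card (F `` {v}) \<le> m"
      by (rule glue_factors[OF less.prems(1,3) order_refl S])
        (use hyp in blast, use odds in blast, use evens in blast, blast)
    have "odd (card (F `` {v})) \<and> card (F `` {v}) \<le> m" if "v \<in> V" for v
    proof (cases "v \<in> S")
      case True
      then have "card (F `` {v}) = m" using F(4) by (meson antisym)
      then show ?thesis using less.prems(4) by simp
    qed (use F(3) that in blast)
    then show ?thesis using F(1,2) unfolding odd_factor_def by blast
  next
    case False
    have slack: "oc E (V - T) + 2 \<le> m * card T" if T: "T \<subseteq> V" "T \<noteq> {}" for T
    proof -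
      have "finite T" "card T \<le> card V"
        using finite_subset[OF T(1) less.prems(1)] card_mono[OF less.prems(1) T(1)] by auto
      then have "even (oc E (V - T)) \<longleftrightarrow> even (card V - card T)"
        using oc_parity[of "V - T" E] less.prems(1,3) T by (simp add: card_Diff_subset)
      then have "even (oc E (V - T)) \<longleftrightarrow> even (m * card T)"
        using \<open>card T \<le> card V\<close> evenV less.prems(4) by (auto simp: even_diff_nat)
      then have "m * card T \<noteq> oc E (V - T) + 1" by fastforce
      moreover have "oc E (V - T) \<noteq> m * card T" using False T by blast
      ultimately show ?thesis using hyp[OF T(1)] by linarith
    qed
    show ?thesis
    proof (cases "\<exists>(x, y) \<in> E. oc (E - {(x, y), (y, x)}) V = 0")
      case True
      then obtain x y where xy: "(x, y) \<in> E" "oc (E - {(x, y), (y, x)}) V = 0" by blast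
      let ?E = "E - {(x, y), (y, x)}"
      have "\<exists>F. odd_factor m ?E V F"
      proof (rule less.hyps)
        have "?E \<subset> E" using xy(1) by blast
        then show "card V + card ?E < card V + card E"
          using psubset_card_mono[OF less.prems(2)] by simp
        show "sym ?E" using less.prems(3) unfolding sym_def by blast
        show "oc ?E (V - T) \<le> m * card T" if "T \<subseteq> V" for T
        proof (cases "T = {}")
          case False
          have "oc ?E (V - T) \<le> oc E (V - T) + 2"
            by (rule oc_delete_edge) (use less.prems(1) in simp)
          then show ?thesis using slack[OF that False] by linarith
        qed (use xy(2) in simp)
      qed (use less.prems in auto)
      then show ?thesis unfolding odd_factor_def by blast
    next
      case bridges: False
      (* In particular no edge leaves V, as deleting it would not affect any component of V. *)
      have EV: "E \<subseteq> V \<times> V"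
      proof (rule subrelI, rule ccontr)
        fix x y assume xy: "(x, y) \<in> E" "(x, y) \<notin> V \<times> V"
        then have "oc (E - {(x, y), (y, x)}) V = oc E V" by (intro oc_Restr) blast
        then show False using bridges xy(1) oc0 by fastforce
      qed
      have "odd (card (E `` {v})) \<and> card (E `` {v}) \<le> m" if v: "v \<in> V" for v
      proof -
        have deg: "card (E `` {v}) = oc E (V - {v})"
          using all_odd_bridges_degree[OF less.prems(1,3) oc0 v] bridges by blast
        have "card (V - {v}) + 1 = card V" using card_Suc_Diff1[OF less.prems(1) v] by simp
        then have "odd (card (V - {v}))" using evenV by presburger
        then have "odd (oc E (V - {v}))" using oc_parity[of "V - {v}" E] less.prems(1,3) by simp
        moreover have "oc E (V - {v}) \<le> m" using hyp[of "{v}"] v by simp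
        ultimately show ?thesis using deg by simp
      qed
      then have "odd_factor m E V E" using EV less.prems(3) unfolding odd_factor_def by blast
      then show ?thesis by blast
    qed
  qed
qed

text \<open>This weaker hypothesis allows a positive surplus. The components left by a set \<open>S\<close> of maximal
  surplus still satisfy the hypothesis of Amahashi's theorem, as this comes from comparing \<open>S\<close> with its
  supersets only; the excess is absorbed by vertices of degree \<open>m + 1\<close> in \<open>S\<close>.\<close>
theorem near_odd_factor_exists:
  assumes "finite V" "finite E" "sym E" "odd m" "m \<ge> 3"
    and hyp: "\<And>T. T \<subseteq> V \<Longrightarrow> oc E (V - T) \<le> (m + 1) * card T"
  shows "\<exists>F. F \<subseteq> E \<inter> V \<times> V \<and> sym F \<and>
    (\<forall>v \<in> V. odd (card (F `` {v})) \<and> card (F `` {v}) \<le> m \<or> card (F `` {v}) = m + 1)"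
proof -
  obtain S where S: "max_surplus m E V S" using max_surplus_exists[OF assms(1)] by blast
  then have SV: "S \<subseteq> V" unfolding max_surplus_def by blast
  have odds: "\<exists>F. odd_factor m (E \<inter> C \<times> C \<union> {(s, c), (c, s)}) (insert s C) F"
    if C: "C \<in> odd_comps E (V - S)" and s: "s \<in> S" "c \<in> C" "(s, c) \<in> E" for C s c
  proof (rule odd_factor_exists)
    have "C \<in> comps E (V - S)" using C odd_comps_sub by blast
    then have "C \<subseteq> V" using compsD(1) by blast
    then show "finite (insert s C)" using finite_subset[OF _ assms(1)] by simp
    show "finite (E \<inter> C \<times> C \<union> {(s, c), (c, s)})" using assms(2) by simp
    show "sym (E \<inter> C \<times> C \<union> {(s, c), (c, s)})" using assms(3) unfolding sym_def by blast
    show "oc (E \<inter> C \<times> C \<union> {(s, c), (c, s)}) (insert s C - T) \<le> m * card T"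
      if "T \<subseteq> insert s C" for T
      by (rule odd_component_hypothesis[OF assms(1,3,4) S C s that])
  qed (use assms in auto)
  have evens: "\<exists>F. odd_factor m E C F" if C: "C \<in> comps E (V - S)" "even (card C)" for C
  proof (rule odd_factor_exists)
    have "C \<subseteq> V" using compsD(1)[OF C(1)] by blast
    then show "finite C" using assms(1) by (rule finite_subset)
    show "oc E (C - T) \<le> m * card T" if "T \<subseteq> C" for T
      by (rule even_component_hypothesis[OF assms(1) S C that])
  qed (use assms in auto)
  obtain F where F: "F \<subseteq> E \<inter> V \<times> V" "sym F"
    "\<And>v. v \<in> V - S \<Longrightarrow> odd (card (F `` {v})) \<and> card (F `` {v}) \<le> m"
    "\<And>v. v \<in> S \<Longrightarrow> m \<le> card (F `` {v}) \<and> card (F `` {v}) \<le> m + 1"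
    by (rule glue_factors[OF assms(1,3) le_add1 S])
      (use hyp in blast, use odds in blast, use evens in blast, blast)
  have "odd (card (F `` {v})) \<and> card (F `` {v}) \<le> m \<or> card (F `` {v}) = m + 1" if "v \<in> V" for v
  proof (cases "v \<in> S")
    case True
    then have "card (F `` {v}) = m \<or> card (F `` {v}) = m + 1" using F(4)[OF True] by linarith
    then show ?thesis using assms(4) by auto
  next
    case False
    then show ?thesis using F(3)[of v] that by simp
  qed
  then show ?thesis using F(1,2) by blast
qed

section \<open>Translation to symmetric digraphs\<close>

lemma finite_components:
  assumes "finite (verts G)" "finite (arcs G)"
  shows "finite (components G)"
proof (rule inj_on_finite)
  show "inj_on (\<lambda>C. (verts C, arcs C)) (components G)"
  proof (rule inj_onI)
    fix C D assume "C \<in> components G" "D \<in> components G" "(verts C, arcs C) = (verts D, arcs D)"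
    then show "C = D"
      unfolding components_def pre_digraph.max_subgraph_def subgraph_def compatible_def
      by (auto intro!: pre_digraph.equality)
  qed
  show "(\<lambda>C. (verts C, arcs C)) ` components G \<subseteq> Pow (verts G) \<times> Pow (arcs G)"
    unfolding components_def pre_digraph.max_subgraph_def subgraph_def by auto
  show "finite (Pow (verts G) \<times> Pow (arcs G))" using assms by simp
qed

text \<open>The set reachable from a vertex is sealed.\<close>
lemma induce_linked_connected:
  assumes "wf_digraph G" "X \<subseteq> verts G" "linked (arcs_ends G) X"
  shows "connected (G \<restriction> X)"
proof -
  interpret wf_digraph G by fact
  interpret I: wf_digraph "G \<restriction> X" by (rule wellformed_induce_subgraph)
  show ?thesis
  proof (rule I.connectedI)
    show "verts (G \<restriction> X) \<noteq> {}" using assms(3) unfolding linked_def by simp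
    fix u v assume "u \<in> verts (G \<restriction> X)" "v \<in> verts (G \<restriction> X)"
    then have uv: "u \<in> X" "v \<in> X" by auto
    let ?Y = "{y. u \<rightarrow>\<^sup>*\<^bsub>G \<restriction> X\<^esub> y}"
    have YX: "?Y \<subseteq> X" using I.reachable_in_verts(2) by auto
    have "sealed (arcs_ends G) X ?Y"
      unfolding sealed_def
    proof (intro allI impI)
      fix a b assume ab: "(a, b) \<in> arcs_ends G" "a \<in> ?Y" "b \<in> X"
      then obtain e where "e \<in> arcs G" "tail G e = a" "head G e = b" by auto
      then have "a \<rightarrow>\<^bsub>G \<restriction> X\<^esub> b" using ab YX by (auto simp: arcs_ends_conv image_iff)
      then show "b \<in> ?Y" using ab(2) I.reachable_adj_trans by blast
    qed
    moreover have "u \<in> ?Y" using uv by simp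
    ultimately have "?Y = X" using assms(3) YX unfolding linked_def by blast
    then have "u \<rightarrow>\<^sup>*\<^bsub>G \<restriction> X\<^esub> v" using uv by blast
    then show "u \<rightarrow>\<^sup>*\<^bsub>mk_symmetric (G \<restriction> X)\<^esub> v" by (rule I.reachable_mk_symmetricI)
  qed
qed

text \<open>A connected subgraph containing \<open>X\<close> cannot leave \<open>X\<close> because \<open>X\<close> is sealed, and it cannot have
  further arcs on \<open>X\<close> because the subgraph induced by \<open>X\<close> has all of them.\<close>
lemma induce_comps_in_components:
  assumes "graph G" "W \<subseteq> verts G" "X \<in> comps (arcs_ends G) W"
  shows "G \<restriction> X \<in> components (G \<restriction> W)"
proof -
  interpret graph G by fact
  have X: "X \<subseteq> W" "linked (arcs_ends G) X" "sealed (arcs_ends G) W X" "X \<noteq> {}"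
    using compsD[OF assms(3)] by auto
  have XV: "X \<subseteq> verts G" using X(1) assms(2) by blast
  have wf: "wf_digraph (G \<restriction> W)" "wf_digraph (G \<restriction> X)"
    by (rule wellformed_induce_subgraph)+
  have symE: "sym (arcs_ends G)" using sym_arcs unfolding symmetric_def .
  have "subgraph (G \<restriction> X) (G \<restriction> W)"
    using X(1) wf unfolding subgraph_def compatible_def by auto
  moreover have "connected (G \<restriction> X)" using XV X(2) by (intro induce_linked_connected wf_digraph)
  moreover have "H = G \<restriction> X"
    if H: "subgraph (G \<restriction> X) H" "subgraph H (G \<restriction> W)" "connected H" for H
  proof -
    have wfH: "wf_digraph H" and ends: "tail H = tail G" "head H = head G"
      and HW: "verts H \<subseteq> W" "arcs H \<subseteq> arcs G"
      and XH: "X \<subseteq> verts H" "arcs (G \<restriction> X) \<subseteq> arcs H"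
      using H(1,2) unfolding subgraph_def compatible_def by auto
    obtain x where x: "x \<in> X" using X(4) by blast
    have step: "b \<in> X" if "(a, b) \<in> parcs (mk_symmetric H)" "a \<in> X" for a b
    proof -
      obtain e where e: "e \<in> arcs H" "(a, b) = (tail H e, head H e) \<or> (a, b) = (head H e, tail H e)"
        using \<open>(a, b) \<in> parcs (mk_symmetric H)\<close> unfolding mk_symmetric_def by auto
      have "(tail G e, head G e) \<in> arcs_ends G"
        using e(1) HW(2) unfolding arcs_ends_conv by blast
      moreover from this have "(head G e, tail G e) \<in> arcs_ends G" using symE by (rule symD[rotated])
      ultimately have "(a, b) \<in> arcs_ends G" using e(2) ends by auto
      moreover have "b \<in> W" using e HW(1) wfH by (auto simp: wf_digraph_def)
      ultimately show ?thesis using sealedD[OF X(3)] that(2) by blast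
    qed
    have "y \<in> X" if "y \<in> verts H" for y
    proof -
      have "x \<rightarrow>\<^sup>*\<^bsub>mk_symmetric H\<^esub> y"
        using H(3) x XH(1) that unfolding connected_def strongly_connected_def by auto
      from reachable_rtranclI[OF this] have "(x, y) \<in> (parcs (mk_symmetric H))\<^sup>*" by simp
      then show ?thesis using x by (induction rule: rtrancl_induct) (auto intro: step)
    qed
    then have vH: "verts H = X" using XH(1) by blast
    have "arcs H \<subseteq> arcs (G \<restriction> X)"
      using HW(2) wfH vH ends unfolding wf_digraph_def by auto
    then have "arcs H = arcs (G \<restriction> X)" using XH(2) by blast
    with vH ends show ?thesis by (auto intro!: pre_digraph.equality)
  qed
  ultimately show ?thesis unfolding components_def pre_digraph.max_subgraph_def by blast
qed

lemma oc_le_num_odd_components: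
  assumes "graph G"
  shows "oc (arcs_ends G) (verts G - S) \<le> num_odd_components (del_verts G S)"
  unfolding num_odd_components_def
proof (rule card_inj_on_le)
  interpret graph G by fact
  let ?W = "verts G - S"
  show "inj_on (\<lambda>X. G \<restriction> X) (odd_comps (arcs_ends G) ?W)"
    by (rule inj_onI) (metis induce_subgraph_verts)
  show "(\<lambda>X. G \<restriction> X) ` odd_comps (arcs_ends G) ?W
      \<subseteq> {C \<in> components (del_verts G S). odd (card (verts C))}"
    using induce_comps_in_components[OF assms, of ?W]
    unfolding odd_comps_def del_verts_def by auto
  have "finite (components (G \<restriction> ?W))"
    by (rule finite_components) (auto intro: finite_subset[OF _ finite_arcs])
  then show "finite {C \<in> components (del_verts G S). odd (card (verts C))}"
    unfolding del_verts_def by simp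
qed

text \<open>Without parallel arcs, arcs leaving a vertex correspond to its neighbours.\<close>
lemma spanning_subgraph_from_rel:
  assumes "graph G" "F \<subseteq> arcs_ends G" "sym F"
  obtains H where "graph H" "spanning H G" "\<And>v. out_degree H v = card (F `` {v})"
proof -
  interpret graph G by fact
  define H where "H = G\<lparr>arcs := {e \<in> arcs G. arc_to_ends G e \<in> F}\<rparr>"
  have H: "verts H = verts G" "arcs H = {e \<in> arcs G. arc_to_ends G e \<in> F}"
    "tail H = tail G" "head H = head G" unfolding H_def by auto
  have eq: "arc_to_ends H = arc_to_ends G" using H(3,4) unfolding arc_to_ends_def by auto
  have ends: "arcs_ends H = F"
    using assms(2) unfolding arcs_ends_def eq H(2) by blast
  have gH: "graph H"
  proof unfold_locales
    show "symmetric H" unfolding symmetric_def ends by (rule assms(3))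
    show "e1 = e2" if "e1 \<in> arcs H" "e2 \<in> arcs H" "arc_to_ends H e1 = arc_to_ends H e2" for e1 e2
      using that no_multi_arcs[of e1 e2] unfolding eq H(2) by blast
  qed (use H no_loops finite_arcs in auto)
  moreover have "spanning H G"
    using gH wf_digraph H
    unfolding spanning_def subgraph_def compatible_def graph_def digraph_def fin_digraph_def by auto
  moreover have "out_degree H v = card (F `` {v})" for v
  proof -
    have "bij_betw (head G) (out_arcs H v) (F `` {v})"
      unfolding bij_betw_def
    proof
      show "inj_on (head G) (out_arcs H v)"
      proof (rule inj_onI)
        fix e1 e2 assume "e1 \<in> out_arcs H v" "e2 \<in> out_arcs H v" "head G e1 = head G e2"
        then show "e1 = e2"
          using no_multi_arcs[of e1 e2] H unfolding arc_to_ends_def by auto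
      qed
      show "head G ` out_arcs H v = F `` {v}"
        using ends[unfolded arcs_ends_conv] H(3,4) by (auto simp: image_iff)
    qed
    then show ?thesis unfolding out_degree_def by (rule bij_betw_same_card)
  qed
  ultimately show thesis by (rule that)
qed

section \<open>The factor theorem\<close>

theorem corollary2p6:
  fixes n :: nat and G :: "('a, 'b) pre_digraph"
  assumes "n \<ge> 2"
    and "graph G"
    and "\<And>S. S \<subseteq> verts G \<Longrightarrow> num_odd_components (del_verts G S) \<le> 2 * n * card S"
  shows "\<exists>F. H_factor n G F"
proof -
  interpret graph G by fact
  define m where "m = 2 * n - 1"
  have m: "odd m" "m \<ge> 3" "m + 1 = 2 * n" using assms(1) unfolding m_def by auto
  have symE: "sym (arcs_ends G)" using sym_arcs unfolding symmetric_def .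
  have finE: "finite (arcs_ends G)" unfolding arcs_ends_def by simp
  have "oc (arcs_ends G) (verts G - T) \<le> (m + 1) * card T" if "T \<subseteq> verts G" for T
    using order_trans[OF oc_le_num_odd_components[OF assms(2)] assms(3)[OF that]] m(3) by simp
  then obtain F where F: "F \<subseteq> arcs_ends G \<inter> verts G \<times> verts G" "sym F"
    and deg: "\<forall>v \<in> verts G.
      odd (card (F `` {v})) \<and> card (F `` {v}) \<le> m \<or> card (F `` {v}) = m + 1"
    using near_odd_factor_exists[OF finite_verts finE symE m(1,2)] by blast
  have "F \<subseteq> arcs_ends G" using F(1) by blast
  then obtain H where H: "graph H" "spanning H G" "\<And>v. out_degree H v = card (F `` {v})"
    using spanning_subgraph_from_rel[OF assms(2) _ F(2)] by blast
  have "card (F `` {v}) \<in> {2 * i + 1 | i. i < n} \<union> {2 * n}" if "v \<in> verts G" for v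
    using bspec[OF deg that]
  proof
    assume odd: "odd (card (F `` {v})) \<and> card (F `` {v}) \<le> m"
    then obtain i where "card (F `` {v}) = 2 * i + 1" by (auto elim: oddE)
    moreover from this have "i < n" using odd m(3) by linarith
    ultimately show ?thesis by blast
  qed (use m(3) in simp)
  then have "H_factor n G H" using H unfolding H_factor_def by simp
  then show ?thesis by blast
qed

end
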